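(* Let $G$ be a connected simple graph that is not isomorphic to any of the graphs $K_{2,l}$ ($l \geq 2$), $W_4$, $E_2 \vee C_4$, $2K_2$, $P_5$, the hammer, and the butterfly. Then $G$ is split if and only if $G/e$ is split for every $e \in E(G)$.
   Context: A graph $G$ is split if $V(G)$ can be partitioned into a clique $K$ and an independent set $S$. $C_n$, $E_n$ denote the cycle and edgeless graph on $n$ vertices; $K_{2,l}$ is the complete bipartite graph with parts of sizes $2$ and $l$; $G\vee H$ is obtained from disjoint $G\cup H$ by adding all edges between $V(G)$ and $V(H)$; $W_4=K_1\vee C_4$. $2K_2$ is the graph consisting of two vertex-disjoint edges; $P_5$ is the path on $5$ vertices. The hammer is the graph on vertices $a,b,x,c,d$ with edges $ab, bx, xc, cd, dx$. The butterfly is the graph on $5$ vertices consisting of two triangles sharing exactly one vertex. For an edge $e=uv$, the graph $G/e$ is obtained from $G$ by adding an edge between $u$ and every neighbour of $v$, then deleting $v$, removing loops and replacing multiple edges by single edges. *)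

theory Defs
  imports "Graph_Theory.Graph_Theory"
begin

text \<open>
  Finite simple graphs are the loopfree symmetric digraphs \<^locale>\<open>pair_graph\<close>: an undirected
  edge \<open>uv\<close> is represented by the two arcs \<open>(u, v)\<close> and \<open>(v, u)\<close>.
  \<^const>\<open>symcl\<close> turns a set of edges, each given in one direction, into such a symmetric
  arc relation.
\<close>

abbreviation isomorphic :: "'a pair_pre_digraph \<Rightarrow> 'b pair_pre_digraph \<Rightarrow> bool" where
  "isomorphic G H \<equiv> digraph_iso (with_proj G) (with_proj H)"

definition clique :: "'a pair_pre_digraph \<Rightarrow> 'a set \<Rightarrow> bool" where
  "clique G K \<longleftrightarrow> K \<subseteq> pverts G \<and> (\<forall>u\<in>K. \<forall>v\<in>K. u \<noteq> v \<longrightarrow> (u, v) \<in> parcs G)"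

definition independent_set :: "'a pair_pre_digraph \<Rightarrow> 'a set \<Rightarrow> bool" where
  "independent_set G S \<longleftrightarrow> S \<subseteq> pverts G \<and> (\<forall>u\<in>S. \<forall>v\<in>S. (u, v) \<notin> parcs G)"

text \<open>As usual for split graphs, either part of the partition may be empty.\<close>

definition split_graph :: "'a pair_pre_digraph \<Rightarrow> bool" where
  "split_graph G \<longleftrightarrow>
     (\<exists>K S. K \<union> S = pverts G \<and> K \<inter> S = {} \<and> clique G K \<and> independent_set G S)"

text \<open>
  \<open>G/uv\<close>: join \<open>u\<close> to all neighbours of \<open>v\<close>, then delete \<open>v\<close> and the resulting loop at \<open>u\<close>.
  There are no multiple edges to remove, since arcs form a set.  The two orientations of an
  edge give isomorphic results, with \<open>u\<close> or \<open>v\<close> as the surviving vertex.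
\<close>

definition contract_edge :: "'a pair_pre_digraph \<Rightarrow> 'a \<times> 'a \<Rightarrow> 'a pair_pre_digraph" where
  "contract_edge G = (\<lambda>(u, v).
     \<lparr>pverts = pverts G - {v},
      parcs = {(x, y) \<in> parcs G \<union> {(u, w) | w. (v, w) \<in> parcs G} \<union> {(w, u) | w. (v, w) \<in> parcs G}.
                 x \<noteq> v \<and> y \<noteq> v \<and> x \<noteq> y}\<rparr>)"

definition complete_graph :: "nat \<Rightarrow> nat pair_pre_digraph" where
  "complete_graph n = \<lparr>pverts = {..<n}, parcs = {(i, j). i < n \<and> j < n \<and> i \<noteq> j}\<rparr>"

definition edgeless_graph :: "nat \<Rightarrow> nat pair_pre_digraph" where
  "edgeless_graph n = \<lparr>pverts = {..<n}, parcs = {}\<rparr>"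

definition path_graph :: "nat \<Rightarrow> nat pair_pre_digraph" where
  "path_graph n = \<lparr>pverts = {..<n}, parcs = {(i, Suc i) | i. Suc i < n}\<^sup>s\<rparr>"

text \<open>Meaningful for \<open>n \<ge> 3\<close> only.\<close>

definition cycle_graph :: "nat \<Rightarrow> nat pair_pre_digraph" where
  "cycle_graph n = \<lparr>pverts = {..<n}, parcs = {(i, Suc i mod n) | i. i < n}\<^sup>s\<rparr>"

text \<open>The sum type makes the vertex sets of the two graphs disjoint.\<close>

definition graph_join ::
  "'a pair_pre_digraph \<Rightarrow> 'b pair_pre_digraph \<Rightarrow> ('a + 'b) pair_pre_digraph" where
  "graph_join G H =
     \<lparr>pverts = pverts G <+> pverts H,
      parcs = {(Inl u, Inl v) | u v. (u, v) \<in> parcs G}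
            \<union> {(Inr u, Inr v) | u v. (u, v) \<in> parcs H}
            \<union> {(Inl u, Inr v) | u v. u \<in> pverts G \<and> v \<in> pverts H}\<^sup>s\<rparr>"

definition wheel_W4 :: "(nat + nat) pair_pre_digraph" where
  "wheel_W4 = graph_join (complete_graph 1) (cycle_graph 4)"

definition two_K2 :: "nat pair_pre_digraph" where
  "two_K2 = \<lparr>pverts = {0, 1, 2, 3}, parcs = {(0, 1), (2, 3)}\<^sup>s\<rparr>"

text \<open>The vertices \<open>a, b, x, c, d\<close> of the hammer are \<open>0, 1, 2, 3, 4\<close>.\<close>

definition hammer :: "nat pair_pre_digraph" where
  "hammer = \<lparr>pverts = {0, 1, 2, 3, 4}, parcs = {(0, 1), (1, 2), (2, 3), (3, 4), (4, 2)}\<^sup>s\<rparr>"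

definition butterfly :: "nat pair_pre_digraph" where
  "butterfly =
     \<lparr>pverts = {0, 1, 2, 3, 4}, parcs = {(0, 1), (1, 2), (2, 0), (2, 3), (3, 4), (4, 2)}\<^sup>s\<rparr>"

end

theory Submission
  imports Defs
begin

text \<open>
  By the Foldes-Hammer characterisation, a non-split graph contains an induced \<open>C\<^sub>5\<close>, \<open>C\<^sub>4\<close> or
  \<open>2K\<^sub>2\<close>.  If every contraction is split, an induced \<open>C\<^sub>5\<close> is impossible, since contracting one of
  its edges leaves an induced \<open>C\<^sub>4\<close>.  Around an induced \<open>C\<^sub>4\<close> or \<open>2K\<^sub>2\<close>, the vertices outside are
  independent, and each arc from an outside vertex into the obstruction forces further arcs,
  because its contraction must destroy the obstruction.  These constraints leave only the
  exceptional graphs.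
\<close>

section \<open>Forbidden induced subgraphs of split graphs\<close>

text \<open>
  Only one orientation of each arc is listed, so that the non-splitness criteria below also
  apply to a relation that is not known to be symmetric, such as that of \<^const>\<open>contract_edge\<close>.
  In a simple graph the remaining vertices are distinct by the listed conditions.
\<close>

definition induced_C4 :: "'a pair_pre_digraph \<Rightarrow> 'a \<Rightarrow> 'a \<Rightarrow> 'a \<Rightarrow> 'a \<Rightarrow> bool" where
  "induced_C4 G a b c d \<longleftrightarrow> {a, b, c, d} \<subseteq> pverts G \<and> a \<noteq> c \<and> b \<noteq> d \<and>
     {(a, b), (b, c), (c, d), (d, a)} \<subseteq> parcs G \<and> {(a, c), (b, d)} \<inter> parcs G = {}"

definition induced_2K2 :: "'a pair_pre_digraph \<Rightarrow> 'a \<Rightarrow> 'a \<Rightarrow> 'a \<Rightarrow> 'a \<Rightarrow> bool" where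
  "induced_2K2 G a b c d \<longleftrightarrow> {a, b, c, d} \<subseteq> pverts G \<and> a \<noteq> d \<and> b \<noteq> d \<and>
     {(a, b), (c, d)} \<subseteq> parcs G \<and> {(a, c), (a, d), (b, c), (b, d)} \<inter> parcs G = {}"

definition induced_C5 :: "'a pair_pre_digraph \<Rightarrow> 'a \<Rightarrow> 'a \<Rightarrow> 'a \<Rightarrow> 'a \<Rightarrow> 'a \<Rightarrow> bool" where
  "induced_C5 G a b c d e \<longleftrightarrow> {a, b, c, d, e} \<subseteq> pverts G \<and>
     {(a, b), (b, c), (c, d), (d, e), (e, a)} \<subseteq> parcs G \<and>
     {(a, c), (a, d), (b, d), (b, e), (c, e)} \<inter> parcs G = {}"

lemma split_graphE:
  assumes "split_graph G"
  obtains K where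
    "\<And>u v. u \<in> K \<Longrightarrow> v \<in> K \<Longrightarrow> u \<noteq> v \<Longrightarrow> (u, v) \<in> parcs G"
    "\<And>u v. u \<in> pverts G \<Longrightarrow> v \<in> pverts G \<Longrightarrow> u \<notin> K \<Longrightarrow> v \<notin> K \<Longrightarrow> (u, v) \<notin> parcs G"
  using assms unfolding split_graph_def clique_def independent_set_def by (metis UnE)

text \<open>The clique part misses one of \<open>a\<close>, \<open>c\<close> and one of
  \<open>b\<close>, \<open>d\<close>; the two missed vertices are adjacent, yet both lie in the
  independent part.\<close>

lemma split_graph_no_induced_C4:
  assumes "split_graph G" shows "\<not> induced_C4 G a b c d"
  using assms by (elim split_graphE) (simp add: induced_C4_def, metis)

text \<open>The independent part misses an end of each edge, so the clique part contains an end of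
  both, and these are not adjacent.\<close>

lemma split_graph_no_induced_2K2:
  assumes "split_graph G" shows "\<not> induced_2K2 G a b c d"
  using assms by (elim split_graphE) (simp add: induced_2K2_def, metis)

text \<open>A clique and an independent set each contain at most two of the five vertices.\<close>

lemma split_graph_no_induced_C5:
  assumes "split_graph G" shows "\<not> induced_C5 G a b c d e"
  using assms by (elim split_graphE) (simp add: induced_C5_def, metis)

context pair_graph
begin

lemma no_self_arc: "(v, v) \<notin> parcs G"
  using no_loops' by blast

lemma arc_commute: "(u, v) \<in> parcs G \<longleftrightarrow> (v, u) \<in> parcs G"
  using arcs_symmetric by blast

text \<open>
  This is the hard direction of the Foldes-Hammer characterisation.  The chosen clique is of
  maximum size and, among these, of maximum degree sum: the summand \<open>card (pverts G)\<close> in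
  the weight makes any enlargement of the clique outweigh a loss of degrees.
\<close>

lemma split_graphI_forbidden:
  assumes no_C4: "\<And>a b c d. \<not> induced_C4 G a b c d"
    and no_2K2: "\<And>a b c d. \<not> induced_2K2 G a b c d"
    and no_C5: "\<And>a b c d e. \<not> induced_C5 G a b c d e"
  shows "split_graph G"
proof -
  let ?V = "pverts G" and ?E = "parcs G"
  define N where "N v = {w. (v, w) \<in> ?E}" for v
  define weight where "weight v = card (N v) + card ?V" for v
  have N_sub: "N v \<subseteq> ?V" for v
    unfolding N_def using in_arcsD2 by blast
  have finV: "finite ?V" by (rule pair_finite_verts)
  have finN: "finite (N v)" for v
    using N_sub finV by (rule finite_subset)
  have card_N: "card (N v) \<le> card ?V" for v
    using N_sub finV by (rule card_mono[rotated])
  have "\<exists>K. clique G K \<and> (\<forall>L. clique G L \<longrightarrow> sum weight L \<le> sum weight K)"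
  proof (rule ex_has_greatest_nat)
    show "clique G {}" by (simp add: clique_def)
    show "\<forall>L. clique G L \<longrightarrow> sum weight L < Suc (sum weight ?V)"
      using finV by (auto simp: clique_def less_Suc_eq_le intro!: sum_mono2)
  qed
  then obtain K where K: "clique G K"
    and max: "\<And>L. clique G L \<Longrightarrow> sum weight L \<le> sum weight K" by blast
  have K_sub: "K \<subseteq> ?V" and K_arc: "\<And>u v. u \<in> K \<Longrightarrow> v \<in> K \<Longrightarrow> u \<noteq> v \<Longrightarrow> (u, v) \<in> ?E"
    using K by (auto simp: clique_def)
  have finK: "finite K" using K_sub finV by (rule finite_subset)

  \<comment> \<open>Weights are positive because \<open>?V\<close> contains \<open>x\<close>, so
    adding a vertex joined to all of \<open>K\<close> would beat the maximum.\<close>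
  have non_nbr: "\<exists>z\<in>K. (x, z) \<notin> ?E" if x: "x \<in> ?V" "x \<notin> K" for x
  proof (rule ccontr)
    assume "\<not> ?thesis"
    then have "clique G (insert x K)"
      using K x arc_commute by (auto simp: clique_def)
    from max[OF this] have "weight x = 0" using finK x by simp
    then show False using x finV by (auto simp: weight_def)
  qed
  \<comment> \<open>Adjacent outer vertices cannot have nested neighbourhoods in \<open>K\<close>:
    exchanging a vertex \<open>z\<close> of \<open>K\<close> for \<open>x\<close> bounds the degree
    of \<open>x\<close>, and this yields a vertex \<open>t\<close> that completes a forbidden
    subgraph.\<close>
  have no_outer_arc: False
    if x: "x \<in> ?V" "x \<notin> K" and y: "y \<in> ?V" "y \<notin> K" and xy: "(x, y) \<in> ?E"
      and nested: "\<And>z. z \<in> K \<Longrightarrow> (x, z) \<notin> ?E \<Longrightarrow> (y, z) \<notin> ?E" for x y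
  proof -
    obtain z where z: "z \<in> K" "(x, z) \<notin> ?E" using non_nbr x by blast
    have yz: "(y, z) \<notin> ?E" using nested z by blast
    \<comment> \<open>\<open>z\<close> is the only non-neighbour of \<open>x\<close> in
      \<open>K\<close>: by \<open>nested\<close>, \<open>y\<close> would miss a second one
      \<open>v\<close> too, and \<open>xy\<close>, \<open>zv\<close> would induce a 2K_2.\<close>
    have x_arc: "(x, v) \<in> ?E" if "v \<in> K" "v \<noteq> z" for v
    proof (rule ccontr)
      assume "(x, v) \<notin> ?E"
      then have "induced_2K2 G x y z v"
        using that x y z xy yz nested K_sub K_arc by (auto simp: induced_2K2_def)
      then show False using no_2K2 by blast
    qed
    have sum_K: "sum weight K = weight z + sum weight (K - {z})"
      using finK z by (simp add: sum.remove)
    \<comment> \<open>The exchange of \<open>z\<close> for \<open>x\<close> keeps the size of the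
      clique, so maximality compares degrees.\<close>
    have "clique G (insert x (K - {z}))"
      using K x x_arc arc_commute by (auto simp: clique_def)
    from max[OF this] have "weight x \<le> weight z"
      using finK x sum_K by simp
    then have deg: "card (N x) \<le> card (N z)" by (simp add: weight_def)
    \<comment> \<open>Otherwise \<open>x\<close> and \<open>y\<close> together could replace
      \<open>z\<close>. The additional summand \<open>card ?V\<close> is at least the degree of
      \<open>z\<close>, and the positive degree of \<open>x\<close> makes the gain strict.\<close>
    have "\<exists>w\<in>K. w \<noteq> z \<and> (y, w) \<notin> ?E"
    proof (rule ccontr)
      assume "\<not> ?thesis"
      then have "clique G (insert y (insert x (K - {z})))"
        using K x y xy x_arc arc_commute by (auto simp: clique_def)
      moreover have "x \<noteq> y" using xy no_self_arc by blast
      ultimately have "weight y + weight x \<le> weight z"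
        using max[of "insert y (insert x (K - {z}))"] finK x y sum_K by simp
      moreover have "card (N x) > 0"
        using xy finN card_gt_0_iff unfolding N_def by blast
      ultimately show False using card_N[of z] by (simp add: weight_def)
    qed
    then obtain w where w: "w \<in> K" "w \<noteq> z" "(y, w) \<notin> ?E" by blast
    \<comment> \<open>\<open>y\<close> lies in \<open>N x\<close> but not in \<open>N z\<close>, so
      an inclusion would be proper and contradict \<open>deg\<close>.\<close>
    have "\<not> N z \<subseteq> N x"
    proof
      assume "N z \<subseteq> N x"
      then have "N z \<subset> N x" using xy yz arc_commute unfolding N_def by blast
      then show False using deg psubset_card_mono[OF finN] by (meson leD)
    qed
    then obtain t where t: "(z, t) \<in> ?E" "(x, t) \<notin> ?E" unfolding N_def by blast
    have t_V: "t \<in> ?V" using t in_arcsD2 by blast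
    have xw: "(x, w) \<in> ?E" and zw: "(z, w) \<in> ?E" using x_arc w K_arc z by auto
    \<comment> \<open>Without this arc, \<open>xy\<close> and \<open>zt\<close> would induce a
      2K_2.\<close>
    have yt: "(y, t) \<in> ?E"
      using no_2K2[of x y z t] x y z t yz xy t_V K_sub arc_commute unfolding induced_2K2_def by blast
    \<comment> \<open>The path \<open>t\<close>, \<open>y\<close>, \<open>x\<close>,
      \<open>w\<close> is closed either by \<open>wt\<close> or through \<open>z\<close>, giving a
      C_4 or a C_5.\<close>
    show False
    proof (cases "(w, t) \<in> ?E")
      case True
      moreover have "x \<noteq> t" "w \<noteq> y" using t z w y arc_commute by auto
      ultimately have "induced_C4 G x w t y"
        using x y w t xw xy yt t_V K_sub arc_commute unfolding induced_C4_def by auto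
      then show False using no_C4 by blast
    next
      case False
      then have "induced_C5 G x w z t y"
        using x y z w t xw zw xy yz yt t_V K_sub arc_commute unfolding induced_C5_def by auto
      then show False using no_C5 by blast
    qed
  qed
  have "independent_set G (?V - K)"
    unfolding independent_set_def
  proof (intro conjI ballI notI)
    fix x y assume "x \<in> ?V - K" "y \<in> ?V - K" and xy: "(x, y) \<in> ?E"
    then have x: "x \<in> ?V" "x \<notin> K" and y: "y \<in> ?V" "y \<notin> K" by auto
    \<comment> \<open>Nestedness fails in both directions; the two witnesses complete
      \<open>x\<close>, \<open>y\<close> to a C_4.\<close>
    obtain u where u: "u \<in> K" "(x, u) \<notin> ?E" "(y, u) \<in> ?E"
      using no_outer_arc[OF x y xy] by blast
    obtain v where v: "v \<in> K" "(y, v) \<notin> ?E" "(x, v) \<in> ?E"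
      using no_outer_arc[OF y x] xy arc_commute by blast
    have "u \<noteq> v" using u v by blast
    moreover have "x \<noteq> u" "y \<noteq> v" using u v x y by auto
    ultimately have "induced_C4 G x y u v"
      using u v x y xy K_sub K_arc arc_commute unfolding induced_C4_def by auto
    then show False using no_C4 by blast
  qed auto
  then show ?thesis
    unfolding split_graph_def using K K_sub by (intro exI[of _ K] exI[of _ "?V - K"]) auto
qed

end

section \<open>Contracting an edge\<close>

lemma pverts_contract_edge [simp]: "pverts (contract_edge G (u, v)) = pverts G - {v}"
  by (simp add: contract_edge_def)

lemma parcs_contract_edge [simp]:
  "(x, y) \<in> parcs (contract_edge G (u, v)) \<longleftrightarrow> x \<noteq> v \<and> y \<noteq> v \<and> x \<noteq> y \<and>
     ((x, y) \<in> parcs G \<or> x = u \<and> (v, y) \<in> parcs G \<or> y = u \<and> (v, x) \<in> parcs G)"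
  by (auto simp: contract_edge_def)

context pair_graph
begin

text \<open>At least one end of the edge lies in the clique, and the merged vertex \<open>u\<close>
  inherits its arcs, so \<open>u\<close> can join the clique. All new arcs touch \<open>u\<close>,
  so the rest of the independent set stays independent.\<close>

lemma split_contract_edge:
  assumes "split_graph G" and uv: "(u, v) \<in> parcs G"
  shows "split_graph (contract_edge G (u, v))"
proof -
  obtain K S where KS: "K \<union> S = pverts G" "K \<inter> S = {}" and K: "clique G K"
    and S: "independent_set G S"
    using assms unfolding split_graph_def by blast
  have "u \<noteq> v" using uv no_self_arc by blast
  have "u \<in> K \<or> v \<in> K" "u \<in> pverts G" "v \<in> pverts G"
    using uv KS S in_arcsD1 in_arcsD2 unfolding independent_set_def by blast+
  then have "clique (contract_edge G (u, v)) (insert u K - {v})"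
    using K \<open>u \<noteq> v\<close> unfolding clique_def by (auto simp: arc_commute)
  moreover have "independent_set (contract_edge G (u, v)) (S - {u, v})"
    using S unfolding independent_set_def by auto
  ultimately show ?thesis
    unfolding split_graph_def using KS \<open>u \<in> pverts G\<close> \<open>u \<noteq> v\<close>
    by (intro exI[of _ "insert u K - {v}"] exI[of _ "S - {u, v}"]) auto
qed

lemma non_isolated:
  assumes "connected (with_proj G)" "u \<in> pverts G" "v \<in> pverts G" "u \<noteq> v"
  shows "\<exists>w. (u, w) \<in> parcs G"
proof -
  have "strongly_connected (with_proj G)"
    using assms(1) by (intro symmetric_connected_imp_strongly_connected) auto
  then have "u \<rightarrow>\<^sup>*\<^bsub>with_proj G\<^esub> v" using assms by (auto simp: strongly_connected_def)
  then show ?thesis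
    using \<open>u \<noteq> v\<close> by (cases rule: converse_reachable_cases) auto
qed

end

section \<open>Isomorphisms with the exceptional graphs\<close>

text \<open>The map starts at \<open>H\<close>, the concrete graph in all uses, whose vertices can
  be listed; \<open>digraph_iso_swap\<close> then reverses the isomorphism.\<close>

lemma isomorphicI:
  assumes wf: "pair_wf_digraph H" and inj: "inj_on f (pverts H)"
    and verts: "f ` pverts H = pverts G" and arcs: "map_prod f f ` parcs H = parcs G"
  shows "isomorphic G H"
proof -
  let ?hom = "\<lparr>iso_verts = f, iso_arcs = map_prod f f, iso_head = snd, iso_tail = fst\<rparr>"
  have wf': "wf_digraph (with_proj H)" using wf by (simp add: wf_digraph_wp_iff)
  have "parcs H \<subseteq> pverts H \<times> pverts H"
    using wf pair_wf_digraph.in_arcsD1 pair_wf_digraph.in_arcsD2 by fastforce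
  then have "inj_on (map_prod f f) (parcs H)"
    using map_prod_inj_on[OF inj inj] inj_on_subset by blast
  then have "pre_digraph.digraph_isomorphism (with_proj H) ?hom"
    using wf' inj by (auto simp: pre_digraph.digraph_isomorphism_def)
  moreover have "with_proj G = app_iso ?hom (with_proj H)"
    using verts arcs by (simp add: app_iso_def with_proj_def)
  ultimately have "digraph_iso (with_proj H) (with_proj G)"
    unfolding digraph_iso_def by blast
  with wf' show ?thesis by (rule digraph_iso_swap)
qed

text \<open>Listing the vertices of \<open>G\<close> in a suitable order reduces the isomorphism to
  comparing two finite adjacency tables.\<close>

lemma isomorphic_nthI:
  assumes G: "pair_wf_digraph G" and H: "pair_wf_digraph H"
    and verts_H: "pverts H = {..<length ws}" and ws: "distinct ws" "set ws = pverts G"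
    and arcs: "\<forall>i\<in>pverts H. \<forall>j\<in>pverts H. (i, j) \<in> parcs H \<longleftrightarrow> (ws ! i, ws ! j) \<in> parcs G"
  shows "isomorphic G H"
proof (rule isomorphicI[OF H])
  show "inj_on (nth ws) (pverts H)"
    using ws verts_H by (auto simp: inj_on_def nth_eq_iff_index_eq)
  show img: "nth ws ` pverts H = pverts G"
    using ws verts_H by (metis atLeast_upt image_set map_nth)
  show "map_prod (nth ws) (nth ws) ` parcs H = parcs G"
  proof (intro equalityI subrelI)
    fix x y assume "(x, y) \<in> map_prod (nth ws) (nth ws) ` parcs H"
    then obtain i j where ij: "(i, j) \<in> parcs H" "x = ws ! i" "y = ws ! j" by auto
    moreover have "i \<in> pverts H" "j \<in> pverts H"
      using pair_wf_digraph.wellformed'[OF H ij(1)] by simp_all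
    ultimately show "(x, y) \<in> parcs G" using arcs by simp
  next
    fix x y assume xy: "(x, y) \<in> parcs G"
    then have "x \<in> nth ws ` pverts H" "y \<in> nth ws ` pverts H"
      unfolding img using pair_wf_digraph.wellformed'[OF G xy] by simp_all
    then obtain i j where "i \<in> pverts H" "j \<in> pverts H" "x = ws ! i" "y = ws ! j" by blast
    with xy arcs show "(x, y) \<in> map_prod (nth ws) (nth ws) ` parcs H"
      by (auto intro: rev_image_eqI)
  qed
qed

lemma symcl_insert: "(insert (a, b) R)\<^sup>s = insert (a, b) (insert (b, a) (R\<^sup>s))"
  by (auto simp: symcl_def)

lemma symcl_empty: "{}\<^sup>s = {}"
  by (simp add: symcl_def)

lemma symcl_Times: "(A \<times> B)\<^sup>s = A \<times> B \<union> B \<times> A"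
  by (force simp: symcl_def)

lemma map_prod_image_Times: "map_prod f g ` (A \<times> B) = f ` A \<times> g ` B"
  by force

lemma map_prod_image_eq: "map_prod f g ` R = {(f u, g v) | u v. (u, v) \<in> R}"
  by force

lemma image_Times_image_eq: "f ` A \<times> g ` B = {(f u, g v) | u v. u \<in> A \<and> v \<in> B}"
  by blast

lemma pverts_graph_join: "pverts (graph_join G H) = Inl ` pverts G \<union> Inr ` pverts H"
  by (auto simp: graph_join_def)

text \<open>In terms of images and products, the image of the arcs under a vertex map can be
  computed by rewriting.\<close>

lemma parcs_graph_join:
  "parcs (graph_join G H) = map_prod Inl Inl ` parcs G \<union> map_prod Inr Inr ` parcs H \<union>
     (Inl ` pverts G \<times> Inr ` pverts H)\<^sup>s"
  unfolding map_prod_image_eq image_Times_image_eq by (simp add: graph_join_def)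

lemma pair_wf_graph_join:
  assumes "pair_wf_digraph G" "pair_wf_digraph H"
  shows "pair_wf_digraph (graph_join G H)"
proof -
  interpret G: pair_wf_digraph G by fact
  interpret H: pair_wf_digraph H by fact
  show ?thesis
    by unfold_locales
      (auto simp: pverts_graph_join parcs_graph_join symcl_Times dest: G.wellformed' H.wellformed')
qed

lemma pair_wf_cycle_graph: "pair_wf_digraph (cycle_graph n)"
  by unfold_locales (auto simp: cycle_graph_def symcl_def)

lemma parcs_cycle_graph_4: "parcs (cycle_graph 4) = {(0, 1), (1, 2), (2, 3), (3, 0)}\<^sup>s"
proof -
  have "{(i, Suc i mod 4) | i. i < 4} = (\<lambda>i. (i, Suc i mod 4)) ` {..<4}"
    by auto
  also have "{..<4::nat} = {0, 1, 2, 3}" by auto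
  also have "(\<lambda>i. (i, Suc i mod 4)) ` {0, 1, 2, 3} = {(0, 1), (1, 2), (2, 3), (3, 0)}" by auto
  finally show ?thesis by (simp only: cycle_graph_def pair_pre_digraph.simps)
qed

lemma pverts_path_graph_5: "pverts (path_graph 5) = {0, 1, 2, 3, 4}"
  by (auto simp: path_graph_def)

lemma parcs_path_graph_5: "parcs (path_graph 5) = {(0, 1), (1, 2), (2, 3), (3, 4)}\<^sup>s"
proof -
  have "{(i, Suc i) | i. Suc i < 5} = (\<lambda>i. (i, Suc i)) ` {..<4}"
    by auto
  also have "{..<4::nat} = {0, 1, 2, 3}" by auto
  also have "(\<lambda>i. (i, Suc i)) ` {0, 1, 2, 3} = {(0, 1), (1, 2), (2, 3), (3, 4)}" by auto
  finally show ?thesis by (simp only: path_graph_def pair_pre_digraph.simps)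
qed

lemma pair_wf_hammer: "pair_wf_digraph hammer"
  by unfold_locales (auto simp: hammer_def symcl_def)

section \<open>Non-split graphs all of whose contractions are split\<close>

lemma (in pair_graph) induced_C4_rotate: "induced_C4 G a b c d \<Longrightarrow> induced_C4 G b c d a"
  by (auto simp: induced_C4_def arc_commute)

lemma (in pair_graph) induced_2K2_swap:
  assumes "induced_2K2 G a b c d"
  shows "induced_2K2 G b a c d" "induced_2K2 G a b d c" "induced_2K2 G c d a b"
  using assms by (auto simp: induced_2K2_def arc_commute)

locale split_contractions = pair_graph +
  assumes connected_G: "connected (with_proj G)"
    and split_contract: "e \<in> parcs G \<Longrightarrow> split_graph (contract_edge G e)"
begin

lemma no_contract_C4: "(u, v) \<in> parcs G \<Longrightarrow> \<not> induced_C4 (contract_edge G (u, v)) a b c d"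
  by (rule split_graph_no_induced_C4[OF split_contract])

lemma no_contract_2K2: "(u, v) \<in> parcs G \<Longrightarrow> \<not> induced_2K2 (contract_edge G (u, v)) a b c d"
  by (rule split_graph_no_induced_2K2[OF split_contract])

lemma no_contract_C5: "(u, v) \<in> parcs G \<Longrightarrow> \<not> induced_C5 (contract_edge G (u, v)) a b c d e"
  by (rule split_graph_no_induced_C5[OF split_contract])

lemma no_induced_C5: "\<not> induced_C5 G a b c d e"
proof
  assume C5: "induced_C5 G a b c d e"
  then have "a \<noteq> c" "b \<noteq> d" "a \<noteq> e" "b \<noteq> e" "c \<noteq> e" "d \<noteq> e" "a \<noteq> b" "b \<noteq> c" "c \<noteq> d" "a \<noteq> d"
    unfolding induced_C5_def by (auto simp: arc_commute no_self_arc)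
  \<comment> \<open>\<open>a\<close> inherits the arc to \<open>d\<close> from \<open>e\<close>, and
    no chord arises because \<open>e\<close> is not adjacent to \<open>c\<close>.\<close>
  with C5 have "induced_C4 (contract_edge G (a, e)) a b c d"
    by (auto simp: induced_C5_def induced_C4_def arc_commute)
  moreover have "(a, e) \<in> parcs G" using C5 by (simp add: induced_C5_def arc_commute)
  ultimately show False using no_contract_C4 by blast
qed

section \<open>Graphs containing an induced four-cycle\<close>

text \<open>Contracting an arc disjoint from the cycle does not change the adjacency on the
  cycle.\<close>

lemma induced_C4_arc_meets:
  assumes C4: "induced_C4 G a b c d" and xy: "(x, y) \<in> parcs G"
    and "x \<notin> {a, b, c, d}" "y \<notin> {a, b, c, d}"
  shows False
proof -
  have "induced_C4 (contract_edge G (x, y)) a b c d"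
    using assms no_self_arc by (auto simp: induced_C4_def)
  then show False using no_contract_C4[OF xy] by blast
qed

text \<open>Contracting \<open>x\<close> into \<open>a\<close> destroys the cycle only by creating
  the chord \<open>ac\<close>, which must come from an arc between \<open>x\<close> and
  \<open>c\<close>.\<close>

lemma induced_C4_opposite:
  assumes C4: "induced_C4 G a b c d" and x: "x \<notin> {a, b, c, d}" and xa: "(x, a) \<in> parcs G"
  shows "(x, c) \<in> parcs G"
proof (rule ccontr)
  assume "(x, c) \<notin> parcs G"
  then have "induced_C4 (contract_edge G (a, x)) a b c d"
    using C4 x no_self_arc by (auto simp: induced_C4_def)
  moreover have "(a, x) \<in> parcs G" using xa arc_commute by blast
  ultimately show False using no_contract_C4 by blast
qed

text \<open>Rotating the cycle makes \<open>induced_C4_opposite\<close> an equivalence on each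
  opposite pair. Connectedness supplies a neighbour of \<open>x\<close>, which must lie on the cycle
  since outside vertices are independent.\<close>

lemma induced_C4_nbrs:
  assumes C4: "induced_C4 G a b c d" and x: "x \<in> pverts G" "x \<notin> {a, b, c, d}"
  shows "(x, a) \<in> parcs G \<longleftrightarrow> (x, c) \<in> parcs G"
    and "(x, b) \<in> parcs G \<longleftrightarrow> (x, d) \<in> parcs G"
    and "(x, a) \<in> parcs G \<or> (x, b) \<in> parcs G"
    and "y \<notin> {a, b, c, d} \<Longrightarrow> (x, y) \<notin> parcs G"
proof -
  have r1: "induced_C4 G b c d a" and r2: "induced_C4 G c d a b" and r3: "induced_C4 G d a b c"
    using C4 induced_C4_rotate by blast+
  show ac: "(x, a) \<in> parcs G \<longleftrightarrow> (x, c) \<in> parcs G"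
    using induced_C4_opposite[OF C4, of x] induced_C4_opposite[OF r2, of x] x by blast
  show bd: "(x, b) \<in> parcs G \<longleftrightarrow> (x, d) \<in> parcs G"
    using induced_C4_opposite[OF r1, of x] induced_C4_opposite[OF r3, of x] x by blast
  have "a \<in> pverts G" using C4 by (simp add: induced_C4_def)
  then obtain w where "(x, w) \<in> parcs G"
    using non_isolated[OF connected_G] x by blast
  then show "(x, a) \<in> parcs G \<or> (x, b) \<in> parcs G"
    using induced_C4_arc_meets[OF C4] x ac bd by blast
  show "(x, y) \<notin> parcs G" if "y \<notin> {a, b, c, d}"
    using induced_C4_arc_meets[OF C4] x that by blast
qed

text \<open>Such an \<open>x\<close> sees only \<open>a\<close> and \<open>c\<close> on the cycle,
  so it can replace \<open>b\<close>; the new cycle is disjoint from the arc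
  \<open>yb\<close>.\<close>

lemma induced_C4_no_mixed:
  assumes C4: "induced_C4 G a b c d"
    and x: "x \<in> pverts G" "x \<notin> {a, b, c, d}" "(x, b) \<notin> parcs G"
    and y: "y \<in> pverts G" "y \<notin> {a, b, c, d}" "(y, b) \<in> parcs G"
  shows False
proof -
  have xac: "(x, a) \<in> parcs G" "(x, c) \<in> parcs G" and xd: "(x, d) \<notin> parcs G"
    using induced_C4_nbrs[OF C4 x(1,2)] x by blast+
  have "induced_C4 G x a d c" using C4 xac xd x by (auto simp: induced_C4_def arc_commute)
  moreover have "x \<noteq> y" using x y by blast
  moreover have "b \<notin> {x, a, d, c}" using C4 x no_self_arc by (auto simp: induced_C4_def)
  ultimately show False using induced_C4_arc_meets[of x a d c y b] y by blast
qed

text \<open>Every outside vertex sees exactly \<open>a\<close> and \<open>c\<close> on the cycle,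
  just like \<open>b\<close> and \<open>d\<close>, so \<open>{a, c}\<close> and the remaining
  vertices are the two parts.\<close>

lemma complete_bipartite_if_no_full:
  assumes C4: "induced_C4 G a b c d"
    and none: "\<And>x. x \<in> pverts G \<Longrightarrow> x \<notin> {a, b, c, d} \<Longrightarrow> (x, b) \<notin> parcs G"
  shows "\<exists>l\<ge>2. complete_bipartite_digraph 2 l (with_proj G)"
proof -
  let ?V = "pverts G - {a, c}"
  have dist: "a \<noteq> b" "b \<noteq> c" "c \<noteq> d" "a \<noteq> d"
    using C4 no_self_arc unfolding induced_C4_def by blast+
  have bd: "{b, d} \<subseteq> ?V" using C4 dist by (auto simp: induced_C4_def)
  have ac: "(x, a) \<in> parcs G \<and> (x, c) \<in> parcs G" if "x \<in> ?V" for x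
    using C4 none[of x] induced_C4_nbrs[OF C4, of x] that
    by (cases "x \<in> {b, d}") (auto simp: induced_C4_def arc_commute)
  have indep: "(x, y) \<notin> parcs G" if "x \<in> ?V" "y \<in> ?V" for x y
  proof (cases "x \<in> {b, d}")
    case True
    then show ?thesis
      using C4 none[of y] induced_C4_nbrs[OF C4, of y] that no_self_arc
      by (cases "y \<in> {b, d}") (auto simp: induced_C4_def arc_commute)
  next
    case False
    then show ?thesis
      using none[of x] induced_C4_nbrs[OF C4, of x] that by (cases "y \<in> {b, d}") auto
  qed
  have arcs: "parcs G = {a, c} \<times> ?V \<union> ?V \<times> {a, c}" (is "_ = ?R")
  proof (intro equalityI subrelI)
    fix x y assume xy: "(x, y) \<in> parcs G"
    then have "x \<in> pverts G" "y \<in> pverts G" "x \<notin> ?V \<or> y \<notin> ?V"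
      using indep in_arcsD1 in_arcsD2 by blast+
    moreover have "(a, c) \<notin> parcs G" "(c, a) \<notin> parcs G"
      using C4 by (auto simp: induced_C4_def arc_commute)
    ultimately show "(x, y) \<in> ?R" using xy no_self_arc by blast
  next
    fix x y assume "(x, y) \<in> ?R"
    then show "(x, y) \<in> parcs G" using ac arc_commute by blast
  qed
  have "card {b, d} \<le> card ?V" using bd pair_finite_verts by (intro card_mono) auto
  then have "2 \<le> card ?V" using C4 by (simp add: induced_C4_def)
  moreover have "complete_bipartite_digraph 2 (card ?V) (with_proj G)"
    unfolding complete_bipartite_digraph_pair_def
  proof (intro conjI exI)
    show "pverts G = {a, c} \<union> ?V" "card {a, c} = 2"
      using C4 by (auto simp: induced_C4_def)
  qed (use pair_finite_verts arcs in simp_all)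
  ultimately show ?thesis by blast
qed

lemma induced_C4_cases:
  assumes C4: "induced_C4 G a b c d"
  shows "(\<exists>l\<ge>2. complete_bipartite_digraph 2 l (with_proj G)) \<or> isomorphic G wheel_W4 \<or>
    isomorphic G (graph_join (edgeless_graph 2) (cycle_graph 4))"
proof -
  let ?X = "pverts G - {a, b, c, d}"
  have C4': "induced_C4 G b c d a" using C4 by (rule induced_C4_rotate)
  have dist: "a \<noteq> b" "b \<noteq> c" "c \<noteq> d" "a \<noteq> d" "a \<noteq> c" "b \<noteq> d"
    using C4 no_self_arc unfolding induced_C4_def by blast+
  have verts: "{a, b, c, d} \<subseteq> pverts G" using C4 by (simp add: induced_C4_def)
  \<comment> \<open>Adjacency to \<open>b\<close> is uniform over \<open>?X\<close>, and by rotation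
    so is adjacency to \<open>c\<close>. An empty \<open>?X\<close> falls under the first two cases,
    which give K_{2,l}.\<close>
  consider "\<And>x. x \<in> ?X \<Longrightarrow> (x, b) \<notin> parcs G" | "\<And>x. x \<in> ?X \<Longrightarrow> (x, c) \<notin> parcs G"
    | "?X \<noteq> {}" "\<And>x. x \<in> ?X \<Longrightarrow> (x, b) \<in> parcs G \<and> (x, c) \<in> parcs G"
    using induced_C4_no_mixed[OF C4] induced_C4_no_mixed[OF C4'] by blast
  then show ?thesis
  proof cases
    case 1
    then show ?thesis using complete_bipartite_if_no_full[OF C4] by blast
  next
    case 2
    then show ?thesis using complete_bipartite_if_no_full[OF C4'] by blast
  next
    case 3
    have full: "(x, a) \<in> parcs G" "(x, b) \<in> parcs G" "(x, c) \<in> parcs G" "(x, d) \<in> parcs G"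
      if "x \<in> ?X" for x
      using 3(2)[OF that] induced_C4_nbrs[OF C4, of x] that by blast+
    have indep: "(x, y) \<notin> parcs G" if "x \<in> ?X" "y \<in> ?X" for x y
      using induced_C4_nbrs(4)[OF C4] that by blast
    \<comment> \<open>\<open>G\<close> is the join of the independent set \<open>?X\<close> with the
      cycle.\<close>
    have arcs: "parcs G = {(a, b), (b, c), (c, d), (d, a)}\<^sup>s \<union> (?X \<times> {a, b, c, d})\<^sup>s"
      (is "_ = ?R")
    proof (intro equalityI subrelI)
      fix x y assume xy: "(x, y) \<in> parcs G"
      then have "x \<in> pverts G" "y \<in> pverts G" using in_arcsD1 in_arcsD2 by blast+
      then consider "x \<in> ?X \<or> y \<in> ?X" | "x \<in> {a, b, c, d}" "y \<in> {a, b, c, d}" by blast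
      then show "(x, y) \<in> ?R"
      proof cases
        case 1
        then have "(x, y) \<in> (?X \<times> {a, b, c, d})\<^sup>s"
          using xy indep in_arcsD1 in_arcsD2 unfolding symcl_Times by blast
        then show ?thesis by blast
      next
        case 2
        then show ?thesis
          using xy C4 no_self_arc arc_commute[of c a] arc_commute[of d b]
          by (auto simp: induced_C4_def symcl_insert)
      qed
    next
      fix x y assume "(x, y) \<in> ?R"
      then consider "(x, y) \<in> {(a, b), (b, c), (c, d), (d, a)}\<^sup>s" | "x \<in> ?X" "y \<in> {a, b, c, d}"
        | "y \<in> ?X" "x \<in> {a, b, c, d}"
        unfolding symcl_Times by blast
      then show "(x, y) \<in> parcs G"
      proof cases
        case 1
        then show ?thesis
          using C4 by (auto simp: induced_C4_def symcl_insert symcl_empty intro: arcs_symmetric)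
      next
        case 2
        then show ?thesis using full by blast
      next
        case 3
        then show ?thesis using full arc_commute by blast
      qed
    qed
    \<comment> \<open>Any enumeration of \<open>?X\<close> is allowed, so that one and two outside
      vertices share the argument.\<close>
    have join: "isomorphic G (graph_join (edgeless_graph (length xs)) (cycle_graph 4))"
      if xs: "distinct xs" "set xs = ?X" for xs
    proof (rule isomorphicI)
      let ?H = "graph_join (edgeless_graph (length xs)) (cycle_graph 4)"
      let ?f = "case_sum (nth xs) (nth [a, b, c, d])"
      have four: "{..<4::nat} = {0, 1, 2, 3}" by auto
      have V: "pverts ?H = Inl ` {..<length xs} \<union> Inr ` {0, 1, 2, 3}"
        by (simp add: pverts_graph_join edgeless_graph_def cycle_graph_def four)
      have nth_xs: "nth xs ` {..<length xs} = ?X"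
        using xs by (metis atLeast_upt image_set map_nth)
      show "pair_wf_digraph ?H"
        by (intro pair_wf_graph_join pair_wf_cycle_graph) (unfold_locales, auto simp: edgeless_graph_def)
      show "inj_on ?f (pverts ?H)"
        unfolding V
      proof (rule inj_on_Un[THEN iffD2], intro conjI)
        show "inj_on ?f (Inl ` {..<length xs})"
          using xs by (auto simp: inj_on_def nth_eq_iff_index_eq)
        show "inj_on ?f (Inr ` {0, 1, 2, 3})"
          using dist by (auto simp: inj_on_def)
        show "?f ` (Inl ` {..<length xs} - Inr ` {0, 1, 2, 3}) \<inter>
            ?f ` (Inr ` {0, 1, 2, 3} - Inl ` {..<length xs}) = {}"
          using arg_cong[OF nth_xs, of "\<lambda>A. A \<inter> {a, b, c, d}"] by (auto simp: set_eq_iff image_iff)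
      qed
      show "?f ` pverts ?H = pverts G"
        unfolding V image_Un image_image using nth_xs verts by auto
      have "map_prod ?f ?f ` parcs ?H = {(a, b), (b, c), (c, d), (d, a)}\<^sup>s \<union> (?X \<times> {a, b, c, d})\<^sup>s"
        unfolding parcs_graph_join parcs_cycle_graph_4 image_Un symcl_Times map_prod_image_Times
        by (simp add: edgeless_graph_def cycle_graph_def four image_image nth_xs symcl_insert symcl_empty)
      then show "map_prod ?f ?f ` parcs ?H = parcs G" by (simp only: arcs)
    qed
    obtain f where f: "f \<in> ?X" using 3(1) by blast
    \<comment> \<open>With three outside vertices \<open>f\<close>, \<open>g\<close>,
      \<open>y\<close>, the cycle \<open>g b y d\<close> would be disjoint from the arc
      \<open>fa\<close>.\<close>
    have two: "y = g" if "g \<in> ?X" "g \<noteq> f" "y \<in> ?X" "y \<noteq> f" for g y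
    proof (rule ccontr)
      assume "y \<noteq> g"
      then have "induced_C4 G g b y d"
        using that full[of g] full[of y] indep[of g y] C4 dist
        by (auto simp: induced_C4_def arc_commute)
      then show False
        using induced_C4_arc_meets[of g b y d f a] full[OF f] f that dist by auto
    qed
    show ?thesis
    proof (cases "?X = {f}")
      case True
      moreover have "complete_graph 1 = edgeless_graph 1"
        by (auto simp: complete_graph_def edgeless_graph_def)
      ultimately show ?thesis using join[of "[f]"] by (simp add: wheel_W4_def)
    next
      case False
      then obtain g where g: "g \<in> ?X" "g \<noteq> f" using f by blast
      then have "?X = {f, g}" using f two by blast
      then show ?thesis using join[of "[f, g]"] g by (simp add: numeral_2_eq_2)
    qed
  qed
qed

section \<open>Graphs containing an induced 2K_2\<close>

lemma induced_2K2_arc_meets: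
  assumes K: "induced_2K2 G a b c d" and xy: "(x, y) \<in> parcs G"
    and "x \<notin> {a, b, c, d}" "y \<notin> {a, b, c, d}"
  shows False
proof -
  have "induced_2K2 (contract_edge G (x, y)) a b c d"
    using assms no_self_arc by (auto simp: induced_2K2_def)
  then show False using no_contract_2K2[OF xy] by blast
qed

text \<open>Contracting \<open>x\<close> into \<open>a\<close> destroys the 2K_2 only if
  \<open>a\<close> inherits an arc to \<open>c\<close> or \<open>d\<close>.\<close>

lemma induced_2K2_nbr_opposite:
  assumes K: "induced_2K2 G a b c d" and x: "x \<notin> {a, b, c, d}" and xa: "(x, a) \<in> parcs G"
  shows "(x, c) \<in> parcs G \<or> (x, d) \<in> parcs G"
proof (rule ccontr)
  assume "\<not> ?thesis"
  then have "induced_2K2 (contract_edge G (a, x)) a b c d"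
    using K x no_self_arc by (auto simp: induced_2K2_def)
  moreover have "(a, x) \<in> parcs G" using xa arc_commute by blast
  ultimately show False using no_contract_2K2 by blast
qed

text \<open>Connectedness gives \<open>x\<close> a neighbour on one of the two edges;
  \<open>induced_2K2_nbr_opposite\<close>, up to the symmetries of 2K_2, gives one on the
  other.\<close>

lemma induced_2K2_nbrs:
  assumes K: "induced_2K2 G a b c d" and x: "x \<in> pverts G" "x \<notin> {a, b, c, d}"
  shows "(x, a) \<in> parcs G \<or> (x, b) \<in> parcs G" and "(x, c) \<in> parcs G \<or> (x, d) \<in> parcs G"
proof -
  have "a \<in> pverts G" using K by (simp add: induced_2K2_def)
  then obtain w where w: "(x, w) \<in> parcs G"
    using non_isolated[OF connected_G] x by blast
  then have "w \<in> {a, b, c, d}" using induced_2K2_arc_meets[OF K] x by blast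
  moreover have "induced_2K2 G b a c d" "induced_2K2 G c d a b" "induced_2K2 G d c a b"
    using K induced_2K2_swap by blast+
  ultimately show "(x, a) \<in> parcs G \<or> (x, b) \<in> parcs G" "(x, c) \<in> parcs G \<or> (x, d) \<in> parcs G"
    using w K x induced_2K2_nbr_opposite[of _ _ _ _ x] by blast+
qed

text \<open>This serves as a without-loss-of-generality step; the equation
  \<open>{c', d'} = {c, d}\<close> carries facts about outside vertices over to the new
  labels.\<close>

lemma induced_2K2_choose:
  assumes K: "induced_2K2 G a b c d" and x: "x \<in> pverts G" "x \<notin> {a, b, c, d}"
  obtains c' d' where "induced_2K2 G a b c' d'" "{c', d'} = {c, d}" "(x, c') \<in> parcs G"
proof (cases "(x, c) \<in> parcs G")
  case True
  then show ?thesis using that[OF K] by simp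
next
  case False
  then show ?thesis
    using that[OF induced_2K2_swap(2)[OF K]] induced_2K2_nbrs(2)[OF K x] by (simp add: insert_commute)
qed

text \<open>A second common neighbour on the edge \<open>cd\<close> would close a C_4 through
  \<open>a\<close>. Hence \<open>x\<close> and \<open>y\<close> attach to different ends of that
  edge, which closes a C_5.\<close>

lemma induced_2K2_no_common_nbr:
  assumes no_C4: "\<And>a b c d. \<not> induced_C4 G a b c d" and K: "induced_2K2 G a b c d"
    and x: "x \<in> pverts G" "x \<notin> {a, b, c, d}" and y: "y \<in> pverts G" "y \<notin> {a, b, c, d}"
    and "x \<noteq> y" and xa: "(x, a) \<in> parcs G" and ya: "(y, a) \<in> parcs G"
  shows False
proof -
  have xy: "(x, y) \<notin> parcs G" using induced_2K2_arc_meets[OF K] x y by blast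
  obtain c' d' where K': "induced_2K2 G a b c' d'" and eq: "{c', d'} = {c, d}"
    and xc: "(x, c') \<in> parcs G"
    using induced_2K2_choose[OF K x] by blast
  have yn: "(y, c') \<in> parcs G \<or> (y, d') \<in> parcs G"
    using induced_2K2_nbrs(2)[OF K'] y eq by blast
  have no_common: "\<not> ((x, z) \<in> parcs G \<and> (y, z) \<in> parcs G)" if "z \<in> {c', d'}" for z
  proof
    assume "(x, z) \<in> parcs G \<and> (y, z) \<in> parcs G"
    then have "induced_C4 G x a y z"
      using that K' x y xa ya xy \<open>x \<noteq> y\<close> by (auto simp: induced_C4_def induced_2K2_def arc_commute)
    then show False using no_C4 by blast
  qed
  then have "induced_C5 G x a y d' c'"
    using K' x y xa ya xy xc yn by (auto simp: induced_C5_def induced_2K2_def arc_commute)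
  then show False using no_induced_C5 by blast
qed

text \<open>
  Since common neighbours are excluded, two outside vertices would close an induced \<open>C\<^sub>6\<close>,
  which contracts to \<open>C\<^sub>5\<close>.
\<close>

lemma induced_2K2_outer_unique:
  assumes no_C4: "\<And>a b c d. \<not> induced_C4 G a b c d" and K: "induced_2K2 G a b c d"
    and x: "x \<in> pverts G" "x \<notin> {a, b, c, d}" and y: "y \<in> pverts G" "y \<notin> {a, b, c, d}"
  shows "x = y"
proof (rule ccontr)
  assume "x \<noteq> y"
  have xy: "(x, y) \<notin> parcs G" using induced_2K2_arc_meets[OF K] x y by blast
  obtain c' d' where K1: "induced_2K2 G a b c' d'" and eq1: "{c', d'} = {c, d}"
    and xc: "(x, c') \<in> parcs G"
    using induced_2K2_choose[OF K x] by blast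
  have x1: "x \<notin> {c', d', a, b}" using x eq1 by blast
  obtain a' b' where K2: "induced_2K2 G c' d' a' b'" and eq2: "{a', b'} = {a, b}"
    and xa: "(x, a') \<in> parcs G"
    using induced_2K2_choose[OF induced_2K2_swap(3)[OF K1] x(1) x1] by blast
  have K3: "induced_2K2 G a' b' c' d'" and K4: "induced_2K2 G b' a' c' d'"
    and K5: "induced_2K2 G d' c' a' b'"
    using K2 induced_2K2_swap by blast+
  have x2: "x \<notin> {a', b', c', d'}" and y2: "y \<notin> {a', b', c', d'}" using x y eq1 eq2 by blast+
  \<comment> \<open>\<open>K2\<close> to \<open>K5\<close> bring each of the four vertices into
    first position.\<close>
  have no_common: "\<not> ((x, z) \<in> parcs G \<and> (y, z) \<in> parcs G)" if "z \<in> {a', b', c', d'}" for z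
    using that x2 y2 x(1) y(1) \<open>x \<noteq> y\<close> induced_2K2_no_common_nbr[OF no_C4 K2, of x y]
      induced_2K2_no_common_nbr[OF no_C4 K3, of x y] induced_2K2_no_common_nbr[OF no_C4 K4, of x y]
      induced_2K2_no_common_nbr[OF no_C4 K5, of x y]
    by blast
  \<comment> \<open>\<open>y\<close> has a neighbour on each edge, and \<open>a'\<close>,
    \<open>c'\<close> are already neighbours of \<open>x\<close>.\<close>
  have y_arcs: "(y, b') \<in> parcs G" "(y, d') \<in> parcs G"
    using induced_2K2_nbrs[OF K3 y(1) y2] no_common xa xc by blast+
  then have "(x, d') \<notin> parcs G" "(y, c') \<notin> parcs G" using no_common xc by blast+
  \<comment> \<open>The six-cycle is \<open>x a' b' y d' c'\<close>, and \<open>b'\<close> is merged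
    into \<open>a'\<close>.\<close>
  then have "induced_C5 (contract_edge G (a', b')) x a' y d' c'"
    using K3 x(1) y(1) x2 y2 xy xa xc y_arcs no_self_arc \<open>x \<noteq> y\<close>
    by (auto simp: induced_C5_def induced_2K2_def arc_commute)
  moreover have "(a', b') \<in> parcs G" using K3 by (simp add: induced_2K2_def)
  ultimately show False using no_contract_C5 by blast
qed

text \<open>At most one vertex \<open>x\<close> lies outside. After relabelling it is adjacent to
  one chosen end of each edge, so only its adjacency to the other two ends remains open.\<close>

lemma induced_2K2_cases:
  assumes no_C4: "\<And>a b c d. \<not> induced_C4 G a b c d" and K: "induced_2K2 G a b c d"
  shows "isomorphic G two_K2 \<or> isomorphic G (path_graph 5) \<or> isomorphic G hammer \<or>
    isomorphic G butterfly"
proof (cases "pverts G = {a, b, c, d}")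
  case True
  have "isomorphic G two_K2"
  proof (rule isomorphic_nthI)
    show "distinct [a, b, c, d]"
      using K by (auto simp: induced_2K2_def no_self_arc arc_commute)
    show "pair_wf_digraph two_K2"
      by unfold_locales (auto simp: two_K2_def symcl_def)
    show "pverts two_K2 = {..<length [a, b, c, d]}" by (auto simp: two_K2_def)
    show "\<forall>i\<in>pverts two_K2. \<forall>j\<in>pverts two_K2.
        (i, j) \<in> parcs two_K2 \<longleftrightarrow> ([a, b, c, d] ! i, [a, b, c, d] ! j) \<in> parcs G"
      using K by (simp add: two_K2_def induced_2K2_def symcl_insert symcl_empty no_self_arc arc_commute)
    show "set [a, b, c, d] = pverts G" using True by simp
  qed (fact pair_wf_digraph)
  then show ?thesis by blast
next
  case False
  then obtain x where x: "x \<in> pverts G" "x \<notin> {a, b, c, d}"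
    using K by (auto simp: induced_2K2_def)
  have "y = x" if "y \<in> pverts G" "y \<notin> {a, b, c, d}" for y
    using induced_2K2_outer_unique[OF no_C4 K x that] by simp
  moreover have "{a, b, c, d} \<subseteq> pverts G" using K by (simp add: induced_2K2_def)
  ultimately have V: "pverts G = {a, b, c, d, x}" using x by blast
  obtain c' d' where K1: "induced_2K2 G a b c' d'" and eq1: "{c', d'} = {c, d}"
    and xc: "(x, c') \<in> parcs G"
    using induced_2K2_choose[OF K x] by blast
  have x1: "x \<notin> {c', d', a, b}" using x eq1 by blast
  obtain a' b' where K2: "induced_2K2 G c' d' a' b'" and eq2: "{a', b'} = {a, b}"
    and xa: "(x, a') \<in> parcs G"
    using induced_2K2_choose[OF induced_2K2_swap(3)[OF K1] x(1) x1] by blast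
  have V': "pverts G = {a', b', c', d', x}" using V eq1 eq2 by blast
  have dist: "distinct [a', b', c', d', x]"
  proof -
    have "x \<notin> {a', b', c', d'}" using x1 eq2 by blast
    then show ?thesis using K2 by (auto simp: induced_2K2_def no_self_arc arc_commute)
  qed
  note arcs = K2[unfolded induced_2K2_def] xa xc
  \<comment> \<open>Each further arc at \<open>x\<close> closes a triangle on one of the two edges:
    none gives P_5, one gives the hammer, both give the butterfly.\<close>
  consider "(x, b') \<notin> parcs G" "(x, d') \<notin> parcs G" | "(x, b') \<notin> parcs G" "(x, d') \<in> parcs G"
    | "(x, b') \<in> parcs G" "(x, d') \<notin> parcs G" | "(x, b') \<in> parcs G" "(x, d') \<in> parcs G"
    by blast
  then show ?thesis
  proof cases
    case 1
    have "isomorphic G (path_graph 5)"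
    proof (rule isomorphic_nthI)
      show "\<forall>i\<in>pverts (path_graph 5). \<forall>j\<in>pverts (path_graph 5).
          (i, j) \<in> parcs (path_graph 5) \<longleftrightarrow> ([b', a', x, c', d'] ! i, [b', a', x, c', d'] ! j) \<in> parcs G"
        unfolding parcs_path_graph_5 using 1 arcs
        by (simp add: pverts_path_graph_5 symcl_insert symcl_empty no_self_arc arc_commute)
      show "pair_wf_digraph (path_graph 5)"
        by unfold_locales (auto simp: path_graph_def symcl_def)
      show "pverts (path_graph 5) = {..<length [b', a', x, c', d']}" by (auto simp: path_graph_def)
      show "set [b', a', x, c', d'] = pverts G" using V' by auto
      show "distinct [b', a', x, c', d']" using dist by auto
    qed (fact pair_wf_digraph)
    then show ?thesis by blast
  next
    case 2
    have "isomorphic G hammer"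
    proof (rule isomorphic_nthI)
      show "\<forall>i\<in>pverts hammer. \<forall>j\<in>pverts hammer.
          (i, j) \<in> parcs hammer \<longleftrightarrow> ([b', a', x, c', d'] ! i, [b', a', x, c', d'] ! j) \<in> parcs G"
        using 2 arcs by (simp add: hammer_def symcl_insert symcl_empty no_self_arc arc_commute)
      show "pverts hammer = {..<length [b', a', x, c', d']}" by (auto simp: hammer_def)
      show "set [b', a', x, c', d'] = pverts G" using V' by auto
      show "distinct [b', a', x, c', d']" using dist by auto
    qed (fact pair_wf_digraph pair_wf_hammer)+
    then show ?thesis by blast
  next
    case 3
    have "isomorphic G hammer"
    proof (rule isomorphic_nthI)
      \<comment> \<open>The list is reversed relative to the previous case, since the triangle is
        now on \<open>a'\<close>, \<open>b'\<close>.\<close>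
      show "\<forall>i\<in>pverts hammer. \<forall>j\<in>pverts hammer.
          (i, j) \<in> parcs hammer \<longleftrightarrow> ([d', c', x, a', b'] ! i, [d', c', x, a', b'] ! j) \<in> parcs G"
        using 3 arcs by (simp add: hammer_def symcl_insert symcl_empty no_self_arc arc_commute)
      show "pverts hammer = {..<length [d', c', x, a', b']}" by (auto simp: hammer_def)
      show "set [d', c', x, a', b'] = pverts G" using V' by auto
      show "distinct [d', c', x, a', b']" using dist by auto
    qed (fact pair_wf_digraph pair_wf_hammer)+
    then show ?thesis by blast
  next
    case 4
    have "isomorphic G butterfly"
    proof (rule isomorphic_nthI)
      show "\<forall>i\<in>pverts butterfly. \<forall>j\<in>pverts butterfly.
          (i, j) \<in> parcs butterfly \<longleftrightarrow> ([a', b', x, c', d'] ! i, [a', b', x, c', d'] ! j) \<in> parcs G"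
        using 4 arcs by (simp add: butterfly_def symcl_insert symcl_empty no_self_arc arc_commute)
      show "pair_wf_digraph butterfly"
        by unfold_locales (auto simp: butterfly_def symcl_def)
      show "pverts butterfly = {..<length [a', b', x, c', d']}" by (auto simp: butterfly_def)
      show "set [a', b', x, c', d'] = pverts G" using V' by auto
      show "distinct [a', b', x, c', d']" using dist by auto
    qed (fact pair_wf_digraph)
    then show ?thesis by blast
  qed
qed

end

theorem theorem2p8:
  fixes G :: "'a pair_pre_digraph"
  assumes "pair_graph G"
    and "connected (with_proj G)"
    and "\<And>l. l \<ge> 2 \<Longrightarrow> \<not> complete_bipartite_digraph 2 l (with_proj G)"
    and "\<not> isomorphic G wheel_W4"
    and "\<not> isomorphic G (graph_join (edgeless_graph 2) (cycle_graph 4))"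
    and "\<not> isomorphic G two_K2"
    and "\<not> isomorphic G (path_graph 5)"
    and "\<not> isomorphic G hammer"
    and "\<not> isomorphic G butterfly"
  shows "split_graph G \<longleftrightarrow> (\<forall>e\<in>parcs G. split_graph (contract_edge G e))"
proof
  interpret pair_graph G by fact
  show "\<forall>e\<in>parcs G. split_graph (contract_edge G e)" if "split_graph G"
    using that split_contract_edge by auto
  show "split_graph G" if contr: "\<forall>e\<in>parcs G. split_graph (contract_edge G e)"
  proof -
    interpret split_contractions G
      by unfold_locales (use assms(2) contr in blast)+
    \<comment> \<open>C_4 is excluded first because the 2K_2 classification presupposes its
      absence.\<close>
    have no_C4: "\<not> induced_C4 G a b c d" for a b c d
      using induced_C4_cases[of a b c d] assms(3,4,5) by blast
    moreover have "\<not> induced_2K2 G a b c d" for a b c d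
      using induced_2K2_cases[OF no_C4, of a b c d] assms(6,7,8,9) by blast
    ultimately show ?thesis using no_induced_C5 by (rule split_graphI_forbidden)
  qed
qed

end
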